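(* Let $n\ge 1$. For each integer $k$ with $1\le k\le n$, the number of $(n+1)\times(n+1)$ Toeplitz matrices $\mathcal{A}_n$ over $GF(2)$ with nullity $k$ is $2^{2n-2k}+2^{2n-2k+1}$ (so the number with nullity $1$ is $2^{2n-2}+2^{2n-1}$, with nullity $2$ (if $n\ge2$) is $2^{2n-4}+2^{2n-3}$, and with nullity $n$ is $3$). The number with nullity $n+1$ is $1$ (the zero matrix).
   Context: An $(n+1)\times(n+1)$ Toeplitz matrix $\mathcal{A}_n$ over $GF(2)$ is a matrix whose $(i,j)$ entry ($0\le i,j\le n$) is $a_{j-i}$ if $j\ge i$ and $b_{i-j}$ if $i>j$, where $a_0,\dots,a_n,b_1,\dots,b_n\in GF(2)$. The nullity of $\mathcal{A}_n$ is $\dim\ker(\mathcal{A}_n)$. *)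

theory Defs
  imports "Jordan_Normal_Form.Matrix_Kernel" "HOL-Library.Z2"
begin

definition toeplitz_mat :: "nat \<Rightarrow> (nat \<Rightarrow> 'a) \<Rightarrow> (nat \<Rightarrow> 'a) \<Rightarrow> 'a mat" where
  "toeplitz_mat n a b =
    mat (n + 1) (n + 1) (\<lambda>(i, j). if j \<ge> i then a (j - i) else b (i - j))"

text \<open>
  GF(2) is the field \<^typ>\<open>bit\<close>. Only the values \<open>a 0, \<dots>, a n\<close> and
  \<open>b 1, \<dots>, b n\<close> enter the matrix. As this is a set of matrices rather than of
  parameter sequences, the other values do not affect its cardinality.
\<close>
definition toeplitz_mats :: "nat \<Rightarrow> bit mat set" where
  "toeplitz_mats n = {toeplitz_mat n a b | a b. True}"

text \<open>The nullity of a matrix \<open>A\<close> is \<^term>\<open>kernel_dim A\<close>.\<close>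
definition toeplitz_mats_nullity :: "nat \<Rightarrow> nat \<Rightarrow> bit mat set" where
  "toeplitz_mats_nullity n k = {A \<in> toeplitz_mats n. kernel_dim A = k}"

end

theory Submission
  imports Defs "HOL-Library.Cardinality"
begin

text \<open>
  The entry of a Toeplitz matrix at row \<open>i\<close> and column \<open>j\<close> depends on \<open>n + j - i\<close> only, so the
  matrix is a sequence \<open>s 0, \<dots>, s (2 * n)\<close> over a finite field of \<open>q\<close> elements.
  Read \<open>s\<close> as the linear functional \<open>L\<close> on polynomials with \<open>L (X ^ i) = s i\<close>, and a vector as a polynomial of degree at most \<open>n\<close>. Then the
  kernel of the matrix consists of the \<open>p\<close> with \<open>L (h * p) = 0\<close> for all \<open>h\<close> of degree at most \<open>n\<close>.

  The point is to view this kernel as the last of a chain of spaces. For \<open>m \<le> n\<close> let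
  \<open>I m\<close> be the space of the \<open>p\<close> of degree at most \<open>m\<close> with \<open>L (h * p) = 0\<close> for all \<open>h\<close> of degree at most
  \<open>2 * n - m\<close>; the kernel is \<open>I n\<close>. The dimension of \<open>I m\<close> is zero up to some index and then
  grows by exactly one with each step: it grows by at least one when \<open>I m\<close> is nonzero, since a nonzero
  element of maximal degree can be multiplied by \<open>X\<close> (\<open>card_annihilator_Suc_ge\<close>), and by at most one
  because two elements of \<open>I (m + 1)\<close> constrain each other (\<open>card_annihilator_Suc_le\<close>). Hence the
  nullity is at least \<open>k\<close> if and only if \<open>I (n + 1 - k)\<close> is nonzero, for \<open>1 \<le> k\<close>
  and \<open>k \<le> n + 1\<close> (\<open>annihilator_nonzero_iff_card\<close>).

  To count the sequences for which \<open>I m\<close> is nonzero, count pairs of a sequence and a nonzero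
  element of \<open>I m\<close>. A fixed nonzero \<open>p\<close> imposes a linear recurrence with \<open>q ^ m\<close> solutions, so
  \<open>\<Sum>s. (card (I m) - 1) = (q ^ (m + 1) - 1) * q ^ m\<close> (\<open>sum_card_annihilator\<close>). The growth of the chain
  says that \<open>(card (I (m + 1)) - 1) - q * (card (I m) - 1)\<close> is \<open>q - 1\<close> if \<open>I (m + 1)\<close> is nonzero and \<open>0\<close>
  otherwise. Summing over \<open>s\<close> shows that \<open>I m\<close> is nonzero for exactly \<open>q ^ (2 * m)\<close> sequences
  (\<open>card_annihilator_nonzero\<close>). So \<open>q ^ (2 * (n + 1 - k))\<close> matrices have nullity at least \<open>k\<close>, and
  differences of consecutive counts for \<open>q = 2\<close> give the theorem.
\<close>

section \<open>Cardinalities of spaces over a finite field\<close>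

lemma (in vectorspace) card_carrier_eq_power_dim:
  assumes "fin_dim" and "finite (carrier K)"
  shows "card (carrier V) = card (carrier K) ^ dim"
proof -
  obtain B where B: "finite B" "basis B" using finite_basis_exists[OF assms(1)] by blast
  hence BV: "B \<subseteq> carrier V" by (simp add: basis_def)
  \<comment> \<open>coordinates with respect to \<open>B\<close> identify the space with the functions from \<open>B\<close> to \<open>K\<close>\<close>
  have "\<forall>v. v \<in> carrier V \<longrightarrow> (\<exists>!a. a \<in> B \<rightarrow>\<^sub>E carrier K \<and> lincomb a B = v)"
    using B basis_criterion[OF B(1) BV] by blast
  moreover have "lincomb a B \<in> carrier V" if "a \<in> B \<rightarrow>\<^sub>E carrier K" for a
    using that BV by (intro lincomb_closed) auto
  ultimately have "bij_betw (\<lambda>a. lincomb a B) (B \<rightarrow>\<^sub>E carrier K) (carrier V)"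
    by (intro bij_betwI') metis+
  hence "card (carrier V) = card (B \<rightarrow>\<^sub>E carrier K)" by (simp add: bij_betw_same_card)
  also have "\<dots> = card (carrier K) ^ card B" using B(1) by (simp add: card_PiE)
  also have "card B = dim" using dim_basis[OF B] by simp
  finally show ?thesis .
qed

lemma card_mat_kernel:
  fixes A :: "'a::{field,finite} mat"
  shows "card (mat_kernel A) = CARD('a) ^ kernel_dim A"
proof -
  interpret kernel "dim_row A" "dim_col A" A by unfold_locales auto
  obtain B where B: "finite B" "basis B" using kernel_basis_exists[OF A] by blast
  hence "Ker.fin_dim" by (auto simp: Ker.fin_dim_def Ker.basis_def)
  from Ker.card_carrier_eq_power_dim[OF this] show ?thesis by simp
qed

lemma card_degree_le:
  shows "card {p :: 'a::{field,finite} poly. degree p \<le> m} = CARD('a) ^ Suc m"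
    and "finite {p :: 'a poly. degree p \<le> m}"
proof -
  let ?P = "{p :: 'a poly. degree p \<le> m}"
  have b: "bij_betw (\<lambda>p. restrict (coeff p) {..m}) ?P ({..m} \<rightarrow>\<^sub>E UNIV)"
  proof (rule bij_betw_byWitness[where f' = "\<lambda>f. \<Sum>i\<le>m. monom (f i) i"])
    show "\<forall>p\<in>?P. (\<Sum>i\<le>m. monom (restrict (coeff p) {..m} i) i) = p"
      by (auto simp: poly_as_sum_of_monoms')
    show "\<forall>f\<in>{..m} \<rightarrow>\<^sub>E (UNIV :: 'a set). restrict (coeff (\<Sum>i\<le>m. monom (f i) i)) {..m} = f"
    proof
      fix f :: "nat \<Rightarrow> 'a" assume f: "f \<in> {..m} \<rightarrow>\<^sub>E UNIV"
      have "coeff (\<Sum>i\<le>m. monom (f i) i) k = f k" if "k \<le> m" for k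
        using that by (simp add: coeff_sum)
      with f show "restrict (coeff (\<Sum>i\<le>m. monom (f i) i)) {..m} = f"
        by (auto simp: fun_eq_iff restrict_def PiE_def extensional_def)
    qed
    show "(\<lambda>f. \<Sum>i\<le>m. monom (f i) i) ` ({..m} \<rightarrow>\<^sub>E UNIV) \<subseteq> ?P"
      by (auto intro!: degree_sum_le order.trans[OF degree_monom_le])
  qed (auto split: if_splits)
  show "card ?P = CARD('a) ^ Suc m" using bij_betw_same_card[OF b] by (simp add: card_PiE)
  show "finite ?P" using bij_betw_finite[OF b] by (simp add: finite_PiE)
qed

section \<open>Polynomials annihilated by a sequence\<close>

text \<open>This is the linear functional with \<open>X ^ i \<mapsto> s i\<close>.\<close>

definition moment :: "(nat \<Rightarrow> 'a::comm_ring_1) \<Rightarrow> 'a poly \<Rightarrow> 'a" where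
  "moment s p = (\<Sum>i\<le>degree p. coeff p i * s i)"

lemma moment_eq_sum:
  assumes "degree p \<le> k"
  shows "moment s p = (\<Sum>i\<le>k. coeff p i * s i)"
  unfolding moment_def using assms
  by (intro sum.mono_neutral_left) (auto simp: coeff_eq_0)

lemma moment_0 [simp]: "moment s 0 = 0"
  by (simp add: moment_def)

lemma moment_add: "moment s (p + q) = moment s p + moment s q"
proof -
  let ?k = "max (degree p) (degree q)"
  have "moment s (p + q) = (\<Sum>i\<le>?k. coeff (p + q) i * s i)"
    by (intro moment_eq_sum degree_add_le) auto
  also have "\<dots> = moment s p + moment s q"
    by (simp add: moment_eq_sum[of p ?k] moment_eq_sum[of q ?k] sum.distrib algebra_simps)
  finally show ?thesis .
qed

lemma moment_smult: "moment s (Polynomial.smult c p) = c * moment s p"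
proof -
  have "moment s (Polynomial.smult c p) = (\<Sum>i\<le>degree p. coeff (Polynomial.smult c p) i * s i)"
    by (rule moment_eq_sum[OF degree_smult_le])
  also have "\<dots> = c * moment s p"
    unfolding moment_def coeff_smult sum_distrib_left mult.assoc ..
  finally show ?thesis .
qed

lemma moment_sum: "moment s (sum f A) = (\<Sum>x\<in>A. moment s (f x))"
  by (induction A rule: infinite_finite_induct) (auto simp: moment_add)

lemma moment_monom_mult:
  assumes "degree p \<le> k"
  shows "moment s (monom 1 j * p) = (\<Sum>i\<le>k. coeff p i * s (i + j))"
proof -
  have "degree (monom 1 j * p) \<le> j + k"
    by (intro order.trans[OF degree_mult_le] add_mono degree_monom_le assms)
  hence "moment s (monom 1 j * p) = (\<Sum>i\<le>j + k. coeff (monom 1 j * p) i * s i)"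
    by (rule moment_eq_sum)
  also have "\<dots> = (\<Sum>i\<in>{j..j + k}. coeff p (i - j) * s i)"
    by (intro sum.mono_neutral_cong_right) (auto simp: coeff_monom_mult)
  also have "\<dots> = (\<Sum>i\<le>k. coeff p i * s (i + j))"
    by (intro sum.reindex_bij_witness[of _ "\<lambda>i. i + j" "\<lambda>i. i - j"]) auto
  finally show ?thesis .
qed

text \<open>
  These are the spaces \<open>I m\<close> of the chain, for a functional that is used on degrees up to \<open>N\<close>. The
  cofactor \<open>h\<close> loses a degree when \<open>m\<close> gains one, so that \<open>h * p\<close> always stays within degree \<open>N\<close>;
  in matrix terms the chain runs through the differently shaped Hankel matrices of one sequence.
\<close>

definition annihilator :: "nat \<Rightarrow> (nat \<Rightarrow> 'a::comm_ring_1) \<Rightarrow> nat \<Rightarrow> 'a poly set" where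
  "annihilator N s m = {p. degree p \<le> m \<and> (\<forall>h. degree h + m \<le> N \<longrightarrow> moment s (h * p) = 0)}"

lemma monom_mult_eq_smult:
  fixes c :: "'a::comm_ring_1"
  shows "monom c j * p = Polynomial.smult c (monom 1 j * p)"
  using mult_smult_left[of c "monom 1 j" p] by (simp add: smult_monom del: mult_smult_left)

lemma in_annihilator_iff:
  fixes s :: "nat \<Rightarrow> 'a::comm_ring_1"
  shows "p \<in> annihilator N s m \<longleftrightarrow>
    degree p \<le> m \<and> (\<forall>j. j + m \<le> N \<longrightarrow> (\<Sum>i\<le>m. coeff p i * s (i + j)) = 0)"
proof -
  have "(\<forall>h. degree h + m \<le> N \<longrightarrow> moment s (h * p) = 0) \<longleftrightarrow>
      (\<forall>j. j + m \<le> N \<longrightarrow> moment s (monom 1 j * p) = 0)" (is "?L \<longleftrightarrow> ?R")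
  proof
    assume ?L
    thus ?R by (auto simp: degree_monom_eq)
  next
    assume R: ?R
    show ?L
    proof (intro allI impI)
      fix h :: "'a poly" assume h: "degree h + m \<le> N"
      have "h * p = (\<Sum>j\<le>degree h. Polynomial.smult (coeff h j) (monom 1 j * p))"
        by (subst poly_as_sum_of_monoms[of h, symmetric])
          (simp only: sum_distrib_right monom_mult_eq_smult[symmetric])
      also have "moment s \<dots> = 0"
        using R h by (simp add: moment_sum moment_smult)
      finally show "moment s (h * p) = 0" .
    qed
  qed
  thus ?thesis unfolding annihilator_def by (auto simp: moment_monom_mult)
qed

lemma zero_in_annihilator [simp]: "0 \<in> annihilator N s m"
  by (simp add: annihilator_def)

lemma annihilator_add: "p \<in> annihilator N s m \<Longrightarrow> q \<in> annihilator N s m \<Longrightarrow> p + q \<in> annihilator N s m"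
  by (auto simp: annihilator_def moment_add distrib_left degree_add_le)

lemma annihilator_smult: "p \<in> annihilator N s m \<Longrightarrow> Polynomial.smult c p \<in> annihilator N s m"
  by (auto simp: annihilator_def moment_smult intro: order.trans[OF degree_smult_le])

lemma finite_annihilator [simp]: "finite (annihilator N s m :: 'a::{field,finite} poly set)"
  by (rule finite_subset[OF _ card_degree_le(2)[of m]]) (auto simp: annihilator_def)

lemma card_annihilator_le: "card (annihilator N s m :: 'a::{field,finite} poly set) \<le> CARD('a) ^ Suc m"
  using card_mono[OF card_degree_le(2)[of m], of "annihilator N s m"]
  by (auto simp: card_degree_le(1) annihilator_def)

lemma card_annihilator_pos: "0 < card (annihilator N s m :: 'a::{field,finite} poly set)"
  using zero_in_annihilator finite_annihilator by (metis card_gt_0_iff empty_iff)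

lemma annihilator_mono:
  assumes "m \<le> k" shows "annihilator N s m \<subseteq> annihilator N s k"
  using assms by (auto simp: annihilator_def)

section \<open>Growth of the chain of annihilators\<close>

text \<open>A linear functional has a kernel of codimension at most one.\<close>

lemma card_le_CARD_times_kernel:
  fixes V W :: "'a::{field,finite} poly set"
  assumes "finite W" "W \<noteq> {}"
    and V: "\<And>p g c. p \<in> V \<Longrightarrow> g \<in> V \<Longrightarrow> p + Polynomial.smult c g \<in> V"
    and \<phi>: "\<And>p g c. \<phi> (p + Polynomial.smult c g) = \<phi> p + c * \<phi> g"
    and W: "\<And>p. p \<in> V \<Longrightarrow> \<phi> p = 0 \<Longrightarrow> p \<in> W"
  shows "card V \<le> CARD('a) * card W"
proof (cases "\<exists>g\<in>V. \<phi> g \<noteq> 0")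
  case True
  then obtain g where g: "g \<in> V" "\<phi> g \<noteq> 0" by blast
  have "V \<subseteq> (\<lambda>(c, p). p + Polynomial.smult c g) ` (UNIV \<times> W)"
  proof
    fix p assume p: "p \<in> V"
    let ?c = "\<phi> p / \<phi> g"
    have "\<phi> (p + Polynomial.smult (- ?c) g) = 0" unfolding \<phi> using g(2) by simp
    hence "p + Polynomial.smult (- ?c) g \<in> W" using p g(1) by (intro W V)
    moreover have "p = (p + Polynomial.smult (- ?c) g) + Polynomial.smult ?c g" by simp
    ultimately show "p \<in> (\<lambda>(c, p). p + Polynomial.smult c g) ` (UNIV \<times> W)"
      by (intro image_eqI[of _ _ "(?c, p + Polynomial.smult (- ?c) g)"]) auto
  qed
  hence "card V \<le> card ((UNIV :: 'a set) \<times> W)"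
    using assms(1) by (meson card_image_le card_mono finite_SigmaI finite_imageI finite order.trans)
  thus ?thesis by (simp add: card_cartesian_product)
next
  case False
  hence "card V \<le> card W" using W assms(1) by (intro card_mono) auto
  also have "\<dots> \<le> CARD('a) * card W" by simp
  finally show ?thesis .
qed

text \<open>
  An element \<open>p\<close> of \<open>I (m + 1)\<close> is in \<open>I m\<close> if it has degree at most \<open>m\<close> and \<open>L (X ^ (N - m) * p) = 0\<close>.
  These are two linear conditions, but only one of them is effective. If some \<open>g\<close> in \<open>I (m + 1)\<close>
  has degree \<open>m + 1\<close>, the second follows from the first: \<open>X ^ (N - 2 * m - 1) * g * p\<close> is
  an admissible multiple of \<open>g\<close>, so \<open>L\<close> vanishes on it; as a multiple of \<open>p\<close> it has a
  cofactor of degree exactly \<open>N - m\<close>, all of whose terms below the leading one are admissible, so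
  \<open>L (X ^ (N - m) * p)\<close> vanishes too. If there is no such \<open>g\<close>, the first condition is void.
\<close>

lemma card_annihilator_Suc_le:
  fixes s :: "nat \<Rightarrow> 'a::{field,finite}"
  assumes N: "2 * m + 1 \<le> N"
  shows "card (annihilator N s (Suc m)) \<le> CARD('a) * card (annihilator N s m)"
proof -
  let ?f = "\<lambda>p. moment s (monom 1 (N - m) * p)"
  \<comment> \<open>cofactors of degree below \<open>N - m\<close> are admissible for \<open>I (m + 1)\<close>, so only the top term of \<open>h\<close> counts\<close>
  have split: "moment s (h * p) = coeff h (N - m) * ?f p"
    if p: "p \<in> annihilator N s (Suc m)" and h: "degree h + m \<le> N" for h p
  proof -
    define h' where "h' = h - monom (coeff h (N - m)) (N - m)"
    have "degree h' \<le> N - Suc m"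
    proof (rule degree_le, intro allI impI)
      fix i assume "N - Suc m < i"
      hence "i = N - m \<or> i > degree h \<and> i \<noteq> N - m" using h N by linarith
      thus "coeff h' i = 0" by (auto simp: h'_def coeff_eq_0)
    qed
    hence "moment s (h' * p) = 0" using p N by (auto simp: annihilator_def)
    moreover have "h * p = h' * p + Polynomial.smult (coeff h (N - m)) (monom 1 (N - m) * p)"
      by (simp only: h'_def left_diff_distrib monom_mult_eq_smult[symmetric] diff_add_cancel)
    ultimately show ?thesis by (simp add: moment_add moment_smult)
  qed
  have step: "p \<in> annihilator N s m" if "p \<in> annihilator N s (Suc m)" "degree p \<le> m" "?f p = 0" for p
    unfolding annihilator_def using split[OF that(1)] that(2,3) by auto
  have V: "p + Polynomial.smult c g \<in> annihilator N s (Suc m)"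
    if "p \<in> annihilator N s (Suc m)" "g \<in> annihilator N s (Suc m)" for p g c
    using that by (intro annihilator_add annihilator_smult)
  have ne: "annihilator N s m \<noteq> {}" using zero_in_annihilator by blast
  show ?thesis
  proof (cases "\<exists>g\<in>annihilator N s (Suc m). degree g = Suc m")
    case True
    then obtain g where g: "g \<in> annihilator N s (Suc m)" "degree g = Suc m" by blast
    have f0: "?f p = 0" if p: "p \<in> annihilator N s (Suc m)" "degree p \<le> m" for p
    proof -
      define h where "h = monom 1 (N - 2 * m - 1) * g"
      have deg: "degree h = N - m" using g N by (subst h_def, subst degree_mult_eq) (auto simp: degree_monom_eq)
      hence "h \<noteq> 0" using N by auto
      hence h: "degree h + m \<le> N" "coeff h (N - m) \<noteq> 0"
        using N deg leading_coeff_0_iff[of h] by auto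
      have "degree (monom 1 (N - 2 * m - 1) * p) \<le> (N - 2 * m - 1) + m"
        using p(2) by (intro order.trans[OF degree_mult_le] add_mono degree_monom_le)
      hence "moment s ((monom 1 (N - 2 * m - 1) * p) * g) = 0"
        using g N by (auto simp: annihilator_def)
      hence "moment s (h * p) = 0" by (simp add: h_def mult_ac)
      with split[OF p(1) h(1)] h(2) show ?thesis by simp
    qed
    show ?thesis
    proof (rule card_le_CARD_times_kernel[where \<phi> = "\<lambda>p. coeff p (Suc m)", OF finite_annihilator ne V])
      fix p assume p: "p \<in> annihilator N s (Suc m)" "coeff p (Suc m) = 0"
      hence "degree p \<le> m"
        by (metis (mono_tags, lifting) annihilator_def coeff_0_degree_minus_1 diff_Suc_1
            mem_Collect_eq not_less_eq_eq le_antisym)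
      thus "p \<in> annihilator N s m" using step f0 p by blast
    qed auto
  next
    case False
    show ?thesis
    proof (rule card_le_CARD_times_kernel[where \<phi> = ?f, OF finite_annihilator ne V])
      fix p assume p: "p \<in> annihilator N s (Suc m)" "?f p = 0"
      hence "degree p \<le> m" using False by (metis (mono_tags, lifting) annihilator_def le_SucE mem_Collect_eq)
      thus "p \<in> annihilator N s m" using step p by blast
    qed (auto simp: moment_add moment_smult distrib_left)
  qed
qed

text \<open>
  If \<open>g\<close> is a nonzero element of \<open>I m\<close> of maximal degree, then \<open>X * g\<close> is in \<open>I (m + 1)\<close> but its degree
  exceeds every degree in \<open>I m\<close>.
\<close>

lemma card_annihilator_Suc_ge:
  fixes s :: "nat \<Rightarrow> 'a::{field,finite}"
  assumes "m < N" and ne: "annihilator N s m \<noteq> {0}"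
  shows "CARD('a) * card (annihilator N s m) \<le> card (annihilator N s (Suc m))"
proof -
  let ?D = "degree ` (annihilator N s m - {0})"
  have D: "finite ?D" "?D \<noteq> {}" using ne zero_in_annihilator[of N s m] by auto
  obtain g where "Max ?D = degree g" "g \<in> annihilator N s m - {0}"
    using Max_in[OF D] by (rule imageE)
  hence g: "g \<in> annihilator N s m" "g \<noteq> 0" "degree g = Max ?D" by auto
  have max: "degree p \<le> degree g" if "p \<in> annihilator N s m" for p
    using that D(1) g(3) by (cases "p = 0") auto
  let ?g = "monom 1 1 * g"
  have "?g \<in> annihilator N s (Suc m)"
  proof -
    have "moment s (h * ?g) = 0" if "degree h + Suc m \<le> N" for h
    proof -
      have "degree (h * monom 1 1) \<le> degree h + 1"
        by (intro order.trans[OF degree_mult_le] add_mono degree_monom_le) simp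
      hence "moment s ((h * monom 1 1) * g) = 0" using g(1) that by (auto simp: annihilator_def)
      thus ?thesis by (simp add: mult_ac)
    qed
    moreover have "degree ?g \<le> Suc m"
      using g(1) by (intro order.trans[OF degree_mult_le]) (auto simp: annihilator_def degree_monom_eq)
    ultimately show ?thesis by (simp add: annihilator_def)
  qed
  hence sub: "(\<lambda>(c, p). p + Polynomial.smult c ?g) ` (UNIV \<times> annihilator N s m) \<subseteq> annihilator N s (Suc m)"
    using annihilator_mono[of m "Suc m" N s] by (auto intro!: annihilator_add annihilator_smult)
  have "inj_on (\<lambda>(c, p). p + Polynomial.smult c ?g) (UNIV \<times> annihilator N s m)"
  proof (rule inj_onI, clarify)
    fix c p c' p' assume p: "p \<in> annihilator N s m" "p' \<in> annihilator N s m"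
      and eq: "p + Polynomial.smult c ?g = p' + Polynomial.smult c' ?g"
    have "coeff p (Suc (degree g)) = 0" "coeff p' (Suc (degree g)) = 0"
      using max p by (auto intro!: coeff_eq_0 simp: le_imp_less_Suc)
    with arg_cong[OF eq, of "\<lambda>p. coeff p (Suc (degree g))"] g(2)
    have "c = c'" by (simp add: coeff_monom_mult)
    with eq show "c = c' \<and> p = p'" by simp
  qed
  from card_inj_on_le[OF this sub] show ?thesis by (simp add: card_cartesian_product)
qed

lemma card_annihilator_ge:
  fixes s :: "nat \<Rightarrow> 'a::{field,finite}"
  assumes "annihilator N s m \<noteq> {0}"
  shows "CARD('a) \<le> card (annihilator N s m)"
proof -
  obtain g where g: "g \<in> annihilator N s m" "g \<noteq> 0" using assms zero_in_annihilator[of N s m] by blast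
  have "inj (\<lambda>c. Polynomial.smult c g)"
  proof (rule injI)
    fix x y assume "Polynomial.smult x g = Polynomial.smult y g"
    hence "Polynomial.smult (x - y) g = 0" by (simp add: smult_diff_left)
    thus "x = y" using g(2) by simp
  qed
  moreover have "range (\<lambda>c. Polynomial.smult c g) \<subseteq> annihilator N s m" using g(1) annihilator_smult by auto
  ultimately show ?thesis using card_inj_on_le[of "\<lambda>c. Polynomial.smult c g" UNIV "annihilator N s m"] by simp
qed

lemma two_le_CARD: "2 \<le> CARD('a::{field,finite})"
proof -
  have "card {0, 1 :: 'a} \<le> CARD('a)" by (intro card_mono) auto
  thus ?thesis by simp
qed

text \<open>
  From its first nonzero term on the chain grows by a factor of exactly \<open>q\<close> per step, so the size of a
  later term tells at which index it became nonzero.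
\<close>

lemma annihilator_nonzero_iff_card:
  fixes s :: "nat \<Rightarrow> 'a::{field,finite}"
  assumes "2 * (m + j) \<le> N"
  shows "annihilator N s m \<noteq> {0} \<longleftrightarrow> CARD('a) ^ Suc j \<le> card (annihilator N s (m + j))"
proof (cases "annihilator N s m = {0}")
  case True
  have "card (annihilator N s (m + j)) \<le> CARD('a) ^ j" using assms
  proof (induction j)
    case (Suc j)
    hence "card (annihilator N s (m + Suc j)) \<le> CARD('a) * card (annihilator N s (m + j))"
      using card_annihilator_Suc_le[of "m + j" N s] by simp
    also have "\<dots> \<le> CARD('a) * CARD('a) ^ j" using Suc by (intro mult_left_mono) auto
    finally show ?case by simp
  qed (simp add: True)
  also have "\<dots> < CARD('a) ^ Suc j" using two_le_CARD[where 'a = 'a] by simp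
  finally show ?thesis using True by simp
next
  case False
  have "CARD('a) ^ Suc j \<le> card (annihilator N s (m + j))" using assms
  proof (induction j)
    case 0
    then show ?case using card_annihilator_ge[OF False] by simp
  next
    case (Suc j)
    have "annihilator N s (m + j) \<noteq> {0}" using False annihilator_mono[of m "m + j" N s] zero_in_annihilator[of N s m] by auto
    hence *: "CARD('a) * card (annihilator N s (m + j)) \<le> card (annihilator N s (m + Suc j))"
      using card_annihilator_Suc_ge[of "m + j" N s] Suc.prems by simp
    have "CARD('a) ^ Suc (Suc j) \<le> CARD('a) * card (annihilator N s (m + j))"
      using Suc by simp
    with * show ?case by linarith
  qed
  thus ?thesis using False by simp
qed

section \<open>Counting sequences with a nonzero annihilator\<close>

text \<open>
  Each equation is solvable for its top term \<open>s (degree p + j)\<close>, which does not occur in the earlier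
  equations; hence each one divides the number of solutions by \<open>q\<close>.
\<close>

lemma card_recurrences:
  fixes p :: "'a::{field,finite} poly"
  assumes "p \<noteq> 0" and "degree p + M \<le> N + 1"
  shows "card {s \<in> {..N} \<rightarrow>\<^sub>E UNIV. \<forall>j<M. (\<Sum>i\<le>degree p. coeff p i * s (i + j)) = 0} * CARD('a) ^ M
    = CARD('a) ^ (N + 1)"
  using assms(2)
proof (induction M)
  case 0
  then show ?case by (simp add: card_PiE)
next
  case (Suc M)
  define e where "e = degree p"
  define E where "E = (\<lambda>s j. \<Sum>i\<le>e. coeff p i * s (i + j))"
  define R where "R = (\<lambda>M. {s \<in> {..N} \<rightarrow>\<^sub>E UNIV. \<forall>j<M. E s j = 0})"
  have lead: "coeff p e \<noteq> 0" using assms(1) by (simp add: e_def)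
  have le: "e + M \<le> N" using Suc.prems by (simp add: e_def)
  have upd: "E (s(e + M := x)) j = E s j" if "j < M" for s x j
    unfolding E_def using that by (intro sum.cong) auto
  have updM: "E (s(e + M := s (e + M) + x)) M = E s M + coeff p e * x" for s x
  proof -
    have "(\<Sum>i<e. coeff p i * (s(e + M := s (e + M) + x)) (i + M)) = (\<Sum>i<e. coeff p i * s (i + M))"
      by (intro sum.cong) auto
    thus ?thesis by (simp add: E_def lessThan_Suc_atMost[symmetric] algebra_simps)
  qed
  have PiE: "s(e + M := x) \<in> {..N} \<rightarrow>\<^sub>E UNIV" if "s \<in> {..N} \<rightarrow>\<^sub>E UNIV" for s :: "nat \<Rightarrow> 'a" and x
    using that le by (auto simp: PiE_def extensional_def)
  have "bij_betw (\<lambda>(s, c). s(e + M := s (e + M) + c)) (R (Suc M) \<times> UNIV) (R M)"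
  proof (rule bij_betw_byWitness[where f' =
        "\<lambda>t. (t(e + M := t (e + M) + - (E t M / coeff p e)), E t M / coeff p e)"])
    show "\<forall>a\<in>R (Suc M) \<times> UNIV.
       (\<lambda>t. (t(e + M := t (e + M) + - (E t M / coeff p e)), E t M / coeff p e))
         ((\<lambda>(s, c). s(e + M := s (e + M) + c)) a) = a"
      using lead by (auto simp: R_def updM)
    show "(\<lambda>(s, c). s(e + M := s (e + M) + c)) ` (R (Suc M) \<times> UNIV) \<subseteq> R M"
      by (auto simp: R_def upd intro!: PiE)
    show "(\<lambda>t. (t(e + M := t (e + M) + - (E t M / coeff p e)), E t M / coeff p e)) ` R M
        \<subseteq> R (Suc M) \<times> UNIV"
    proof (rule image_subsetI, intro SigmaI UNIV_I)
      fix t assume t: "t \<in> R M"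
      have "E (t(e + M := t (e + M) + - (E t M / coeff p e))) j = 0" if "j < Suc M" for j
        using that t lead by (cases "j = M") (auto simp: updM upd R_def simp del: add_uminus_conv_diff)
      thus "t(e + M := t (e + M) + - (E t M / coeff p e)) \<in> R (Suc M)"
        using t by (auto simp: R_def simp del: add_uminus_conv_diff intro!: PiE)
    qed
  qed auto
  from bij_betw_same_card[OF this] have "card (R M) = card (R (Suc M)) * CARD('a)"
    by (simp add: card_cartesian_product)
  with Suc show ?case by (simp add: R_def E_def e_def mult_ac)
qed

lemma card_sequences_annihilated:
  fixes p :: "'a::{field,finite} poly"
  assumes "p \<noteq> 0" and "degree p \<le> m" and "m \<le> N"
  shows "card {s \<in> {..N} \<rightarrow>\<^sub>E UNIV. p \<in> annihilator N s m} = CARD('a) ^ m"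
proof -
  have "p \<in> annihilator N s m \<longleftrightarrow> (\<forall>j<N - m + 1. (\<Sum>i\<le>degree p. coeff p i * s (i + j)) = 0)" for s
  proof -
    have "(\<Sum>i\<le>m. coeff p i * s (i + j)) = (\<Sum>i\<le>degree p. coeff p i * s (i + j))" for j
      using assms(2) by (intro sum.mono_neutral_right) (auto simp: coeff_eq_0)
    moreover have "j + m \<le> N \<longleftrightarrow> j < N - m + 1" for j using assms(3) by linarith
    ultimately show ?thesis using assms(2) by (simp add: in_annihilator_iff)
  qed
  hence "card {s \<in> {..N} \<rightarrow>\<^sub>E UNIV. p \<in> annihilator N s m} * CARD('a) ^ (N - m + 1) = CARD('a) ^ (N + 1)"
    using card_recurrences[OF assms(1), of "N - m + 1" N] assms(2,3) by simp
  also have "CARD('a) ^ (N + 1) = CARD('a) ^ m * CARD('a) ^ (N - m + 1)"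
    using assms(3) by (simp flip: power_add)
  finally show ?thesis by simp
qed

text \<open>Double counting of the pairs \<open>(s, p)\<close> with \<open>p\<close> a nonzero element of \<open>I m\<close>.\<close>

lemma sum_card_annihilator:
  assumes "m \<le> N"
  shows "(\<Sum>s\<in>{..N} \<rightarrow>\<^sub>E UNIV. card (annihilator N s m :: 'a::{field,finite} poly set) - 1)
    = (CARD('a) ^ Suc m - 1) * CARD('a) ^ m"
proof -
  let ?S = "{..N} \<rightarrow>\<^sub>E (UNIV :: 'a set)" and ?P = "{p :: 'a poly. degree p \<le> m} - {0}"
  have "card (annihilator N s m) - 1 = card {p \<in> ?P. p \<in> annihilator N s m}" for s :: "nat \<Rightarrow> 'a"
  proof -
    have "{p \<in> ?P. p \<in> annihilator N s m} = annihilator N s m - {0}" by (auto simp: annihilator_def)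
    thus ?thesis by simp
  qed
  hence "(\<Sum>s\<in>?S. card (annihilator N s m) - 1) = (\<Sum>s\<in>?S. card {p \<in> ?P. p \<in> annihilator N s m})" by simp
  also have "\<dots> = (\<Sum>p\<in>?P. card {s \<in> ?S. p \<in> annihilator N s m})"
    using sum_multicount_gen[of ?S ?P "\<lambda>s p. p \<in> annihilator N s m"
        "\<lambda>p. card {s \<in> ?S. p \<in> annihilator N s m}"]
    by (simp add: finite_PiE card_degree_le(2))
  also have "\<dots> = (\<Sum>p\<in>?P. CARD('a) ^ m)"
    using assms by (intro sum.cong) (auto simp: card_sequences_annihilated)
  also have "\<dots> = card ?P * CARD('a) ^ m" by simp
  also have "card ?P = CARD('a) ^ Suc m - 1" by (simp add: card_degree_le)
  finally show ?thesis .
qed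

text \<open>
  The combination \<open>(card (I (k + 1)) - 1) - q * (card (I k) - 1)\<close> is \<open>q - 1\<close> times the indicator of
  \<open>I (k + 1)\<close> being nonzero, so the double count at two consecutive indices isolates the number of sequences.
\<close>

lemma card_annihilator_nonzero:
  assumes "2 * m \<le> N"
  shows "card {s \<in> {..N} \<rightarrow>\<^sub>E UNIV. annihilator N s m \<noteq> {0 :: 'a::{field,finite} poly}} = CARD('a) ^ (2 * m)"
proof (cases m)
  case 0
  have "annihilator N s 0 \<noteq> {0} \<longleftrightarrow> 1 \<in> annihilator N s 0" for s :: "nat \<Rightarrow> 'a"
  proof
    assume "annihilator N s 0 \<noteq> {0}"
    then obtain p where p: "p \<in> annihilator N s 0" "p \<noteq> 0" using zero_in_annihilator[of N s 0] by blast
    then obtain a where "p = [:a:]" "a \<noteq> 0"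
      by (metis (mono_tags, lifting) annihilator_def degree_eq_zeroE le_zero_eq mem_Collect_eq pCons_0_0)
    hence "1 = Polynomial.smult (inverse a) p" by (simp add: one_pCons)
    thus "1 \<in> annihilator N s 0" using annihilator_smult[OF p(1)] by metis
  qed auto
  thus ?thesis using card_sequences_annihilated[of "1 :: 'a poly" 0 N] 0 by simp
next
  case (Suc k)
  let ?S = "{..N} \<rightarrow>\<^sub>E (UNIV :: 'a set)" and ?q = "CARD('a)"
  let ?nz = "\<lambda>s. annihilator N s (Suc k) \<noteq> {0 :: 'a poly}"
  have q: "2 \<le> ?q" by (rule two_le_CARD)
  have "card (annihilator N s (Suc k)) - 1 = ?q * (card (annihilator N s k) - 1) + (if ?nz s then ?q - 1 else 0)"
    for s :: "nat \<Rightarrow> 'a"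
  proof (cases "annihilator N s k = {0}")
    case True
    have "card (annihilator N s (Suc k)) \<le> ?q"
      using card_annihilator_Suc_le[of k N s] True assms Suc by simp
    thus ?thesis using True card_annihilator_ge[of N s "Suc k"] by auto
  next
    case False
    have nz: "?nz s" using False annihilator_mono[of k "Suc k" N s] zero_in_annihilator[of N s k] by auto
    have "card (annihilator N s (Suc k)) = ?q * card (annihilator N s k)"
      using card_annihilator_Suc_le[of k N s] card_annihilator_Suc_ge[OF _ False] assms Suc by simp
    moreover obtain c where "card (annihilator N s k) = Suc c"
      using card_annihilator_pos[of N s k] gr0_implies_Suc by blast
    ultimately show ?thesis using nz q by simp
  qed
  hence "(\<Sum>s\<in>?S. card (annihilator N s (Suc k)) - 1) =
      ?q * (\<Sum>s\<in>?S. card (annihilator N s k) - 1) + (\<Sum>s\<in>?S. if ?nz s then ?q - 1 else 0)"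
    by (simp add: sum.distrib sum_distrib_left)
  also have "(\<Sum>s\<in>?S. if ?nz s then ?q - 1 else 0) = card {s \<in> ?S. ?nz s} * (?q - 1)"
    by (simp add: sum.If_cases finite_PiE Int_def)
  finally have "(?q ^ Suc (Suc k) - 1) * ?q ^ Suc k =
      ?q * ((?q ^ Suc k - 1) * ?q ^ k) + card {s \<in> ?S. ?nz s} * (?q - 1)"
    using assms Suc by (simp only: sum_card_annihilator)
  moreover have "(?q ^ Suc (Suc k) - 1) * ?q ^ Suc k =
      ?q * ((?q ^ Suc k - 1) * ?q ^ k) + ?q ^ (2 * Suc k) * (?q - 1)"
  proof -
    obtain r where r: "?q = Suc r" using q by (cases ?q) auto
    obtain x where x: "?q ^ k = Suc x" using q by (cases "?q ^ k") auto
    have "?q ^ (2 * Suc k) = (?q * ?q ^ k) * (?q * ?q ^ k)"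
      by (simp add: mult_2 power_add)
    thus ?thesis unfolding power_Suc x unfolding r by (simp add: algebra_simps)
  qed
  ultimately have "card {s \<in> ?S. ?nz s} * (?q - 1) = ?q ^ (2 * Suc k) * (?q - 1)" by simp
  thus ?thesis using q Suc by simp
qed


section \<open>Toeplitz matrices as sequences\<close>

text \<open>
  All diagonals are put into one sequence, starting with the one in the lower left corner.
  The index \<open>n + j - i\<close> is never truncated, as \<open>i \<le> n\<close>.
\<close>

definition toeplitz_seq :: "nat \<Rightarrow> (nat \<Rightarrow> 'a) \<Rightarrow> 'a mat" where
  "toeplitz_seq n s = mat (n + 1) (n + 1) (\<lambda>(i, j). s (n + j - i))"

lemma bij_betw_toeplitz_seq:
  "bij_betw (toeplitz_seq n) ({..2 * n} \<rightarrow>\<^sub>E UNIV) {toeplitz_mat n a b |a b. True}"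
proof (rule bij_betw_imageI)
  show "inj_on (toeplitz_seq n) ({..2 * n} \<rightarrow>\<^sub>E (UNIV :: 'a set))"
  proof (rule inj_onI, rule PiE_ext)
    fix s t :: "nat \<Rightarrow> 'a" and l
    assume eq: "toeplitz_seq n s = toeplitz_seq n t" and l: "l \<in> {..2 * n}"
    have "toeplitz_seq n s $$ (n - l, l - n) = toeplitz_seq n t $$ (n - l, l - n)"
      by (simp add: eq)
    moreover have "n + (l - n) - (n - l) = l" "n - l < n + 1" "l - n < n + 1" using l by auto
    ultimately show "s l = t l" by (simp add: toeplitz_seq_def)
  qed
  show "toeplitz_seq n ` ({..2 * n} \<rightarrow>\<^sub>E (UNIV :: 'a set)) = {toeplitz_mat n a b |a b. True}"
  proof (intro equalityI subsetI)
    fix A :: "'a mat" assume "A \<in> toeplitz_seq n ` ({..2 * n} \<rightarrow>\<^sub>E UNIV)"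
    then obtain s where "A = toeplitz_seq n s" by blast
    also have "\<dots> = toeplitz_mat n (\<lambda>d. s (n + d)) (\<lambda>d. s (n - d))"
      unfolding toeplitz_seq_def toeplitz_mat_def by (intro eq_matI) auto
    finally show "A \<in> {toeplitz_mat n a b |a b. True}" by blast
  next
    fix A :: "'a mat" assume "A \<in> {toeplitz_mat n a b |a b. True}"
    then obtain a b where "A = toeplitz_mat n a b" by blast
    also have "\<dots> = toeplitz_seq n (restrict (\<lambda>l. if n \<le> l then a (l - n) else b (n - l)) {..2 * n})"
      unfolding toeplitz_seq_def toeplitz_mat_def by (intro eq_matI) auto
    finally show "A \<in> toeplitz_seq n ` ({..2 * n} \<rightarrow>\<^sub>E UNIV)" by auto
  qed
qed

text \<open>
  Row \<open>i\<close> of the matrix, applied to the coefficients of \<open>p\<close>, gives the functional at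
  \<open>X ^ (n - i) * p\<close>.
\<close>

lemma card_mat_kernel_toeplitz_seq:
  fixes s :: "nat \<Rightarrow> 'a::{field,finite}"
  shows "card (mat_kernel (toeplitz_seq n s)) = card (annihilator (2 * n) s n)"
proof -
  let ?f = "\<lambda>p. vec (n + 1) (coeff p)"
  have mem: "?f p \<in> mat_kernel (toeplitz_seq n s) \<longleftrightarrow> p \<in> annihilator (2 * n) s n" if "degree p \<le> n" for p
  proof -
    have row: "(toeplitz_seq n s *\<^sub>v ?f p) $ i = (\<Sum>j\<le>n. coeff p j * s (j + (n - i)))" if "i \<le> n" for i
    proof -
      have "(toeplitz_seq n s *\<^sub>v ?f p) $ i = (\<Sum>j\<in>{0..<Suc n}. s (n + j - i) * coeff p j)"
        using that by (simp add: toeplitz_seq_def scalar_prod_def)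
      also have "\<dots> = (\<Sum>j\<le>n. coeff p j * s (j + (n - i)))"
        using that by (intro sum.cong) (auto simp: mult.commute add.commute)
      finally show ?thesis .
    qed
    have "?f p \<in> mat_kernel (toeplitz_seq n s) \<longleftrightarrow>
        (\<forall>i\<le>n. (\<Sum>j\<le>n. coeff p j * s (j + (n - i))) = 0)"
    proof -
      have "?f p \<in> mat_kernel (toeplitz_seq n s) \<longleftrightarrow> (\<forall>i<n + 1. (toeplitz_seq n s *\<^sub>v ?f p) $ i = 0)"
        by (auto simp: mat_kernel_def vec_eq_iff toeplitz_seq_def)
      also have "\<dots> \<longleftrightarrow> (\<forall>i\<le>n. (toeplitz_seq n s *\<^sub>v ?f p) $ i = 0)" by (simp add: less_Suc_eq_le)
      finally show ?thesis using row by metis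
    qed
    also have "\<dots> \<longleftrightarrow> (\<forall>d\<le>n. (\<Sum>j\<le>n. coeff p j * s (j + d)) = 0)"
      by (metis diff_diff_cancel diff_le_self)
    also have "\<dots> \<longleftrightarrow> p \<in> annihilator (2 * n) s n"
      using that by (simp add: in_annihilator_iff mult_2)
    finally show ?thesis .
  qed
  have "bij_betw ?f (annihilator (2 * n) s n) (mat_kernel (toeplitz_seq n s))"
  proof (rule bij_betw_imageI)
    show "inj_on ?f (annihilator (2 * n) s n)"
    proof (rule inj_onI)
      fix p q assume pq: "p \<in> annihilator (2 * n) s n" "q \<in> annihilator (2 * n) s n" and eq: "?f p = ?f q"
      hence deg: "degree p \<le> n" "degree q \<le> n" by (auto simp: annihilator_def)
      show "p = q"
      proof (rule poly_eqI)
        fix i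
        show "coeff p i = coeff q i"
        proof (cases "i \<le> n")
          case True
          thus ?thesis using arg_cong[OF eq, of "\<lambda>v. v $ i"] by simp
        qed (use deg in \<open>simp add: coeff_eq_0\<close>)
      qed
    qed
    show "?f ` annihilator (2 * n) s n = mat_kernel (toeplitz_seq n s)"
    proof (intro equalityI subsetI)
      fix v assume "v \<in> ?f ` annihilator (2 * n) s n"
      thus "v \<in> mat_kernel (toeplitz_seq n s)" using mem by (auto simp: annihilator_def)
    next
      fix v assume v: "v \<in> mat_kernel (toeplitz_seq n s)"
      define p where "p = (\<Sum>i\<le>n. monom (v $ i) i)"
      have "coeff p i = v $ i" if "i \<le> n" for i using that by (simp add: p_def coeff_sum)
      moreover have "dim_vec v = n + 1" using v by (auto simp: mat_kernel_def toeplitz_seq_def)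
      ultimately have vp: "v = ?f p" by (intro eq_vecI) auto
      have "degree p \<le> n"
        unfolding p_def by (intro degree_sum_le order.trans[OF degree_monom_le]) auto
      with mem v vp have "p \<in> annihilator (2 * n) s n" by blast
      with vp show "v \<in> ?f ` annihilator (2 * n) s n" by blast
    qed
  qed
  from bij_betw_same_card[OF this] show ?thesis by simp
qed

theorem card_toeplitz_kernel_dim_ge:
  assumes "1 \<le> k" and "k \<le> n + 1"
  shows "card {A \<in> {toeplitz_mat n a b |a b. True}. k \<le> kernel_dim (A :: 'a::{field,finite} mat)}
    = CARD('a) ^ (2 * (n + 1 - k))"
proof -
  let ?S = "{..2 * n} \<rightarrow>\<^sub>E (UNIV :: 'a set)" and ?q = "CARD('a)"
  have iff: "k \<le> kernel_dim (toeplitz_seq n s) \<longleftrightarrow> annihilator (2 * n) s (n + 1 - k) \<noteq> {0}" for s :: "nat \<Rightarrow> 'a"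
  proof -
    have "k \<le> kernel_dim (toeplitz_seq n s) \<longleftrightarrow> ?q ^ k \<le> ?q ^ kernel_dim (toeplitz_seq n s)"
      using two_le_CARD[where 'a = 'a] by (subst power_increasing_iff) auto
    also have "?q ^ kernel_dim (toeplitz_seq n s) = card (annihilator (2 * n) s n)"
      by (simp add: card_mat_kernel_toeplitz_seq flip: card_mat_kernel)
    also have "?q ^ k \<le> card (annihilator (2 * n) s n) \<longleftrightarrow> annihilator (2 * n) s (n + 1 - k) \<noteq> {0}"
      using annihilator_nonzero_iff_card[of "n + 1 - k" "k - 1" "2 * n" s] assms by simp
    finally show ?thesis .
  qed
  have "{A \<in> {toeplitz_mat n a b |a b. True}. k \<le> kernel_dim A}
      = toeplitz_seq n ` {s \<in> ?S. annihilator (2 * n) s (n + 1 - k) \<noteq> {0}}"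
    using bij_betw_imp_surj_on[OF bij_betw_toeplitz_seq[of n, where 'a = 'a], symmetric]
    by (auto simp: iff)
  moreover have "inj_on (toeplitz_seq n) {s \<in> ?S. annihilator (2 * n) s (n + 1 - k) \<noteq> {0}}"
    using bij_betw_imp_inj_on[OF bij_betw_toeplitz_seq] by (rule inj_on_subset) auto
  ultimately have "card {A \<in> {toeplitz_mat n a b |a b. True}. k \<le> kernel_dim (A :: 'a mat)}
      = card {s \<in> ?S. annihilator (2 * n) s (n + 1 - k) \<noteq> {0}}" by (simp add: card_image)
  also have "\<dots> = ?q ^ (2 * (n + 1 - k))" using assms by (intro card_annihilator_nonzero) auto
  finally show ?thesis .
qed

section \<open>The count over GF(2)\<close>

lemma UNIV_bit: "(UNIV :: bit set) = {0, 1}"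
  by (auto intro: bit.exhaust)

instance bit :: finite
proof
  show "finite (UNIV :: bit set)" unfolding UNIV_bit by simp
qed

lemma CARD_bit: "CARD(bit) = 2"
  unfolding UNIV_bit by simp

lemma finite_toeplitz_mats: "finite (toeplitz_mats n)"
  using bij_betw_finite[OF bij_betw_toeplitz_seq[of n, where 'a = bit]]
  by (simp add: toeplitz_mats_def finite_PiE)

lemma card_toeplitz_mats_nullity_ge:
  assumes "1 \<le> k" and "k \<le> n + 1"
  shows "card {A \<in> toeplitz_mats n. k \<le> kernel_dim A} = 4 ^ (n + 1 - k)"
  using card_toeplitz_kernel_dim_ge[OF assms, where 'a = bit]
  by (simp add: toeplitz_mats_def CARD_bit power_mult)

lemma card_toeplitz_mats_nullity:
  assumes "1 \<le> k" and "k \<le> n"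
  shows "card (toeplitz_mats_nullity n k) = 3 * 4 ^ (n - k)"
proof -
  let ?G = "\<lambda>k. {A \<in> toeplitz_mats n. k \<le> kernel_dim A}"
  have "toeplitz_mats_nullity n k = ?G k - ?G (Suc k)"
    by (auto simp: toeplitz_mats_nullity_def)
  hence "card (toeplitz_mats_nullity n k) = card (?G k) - card (?G (Suc k))"
    using finite_toeplitz_mats by (simp only:) (rule card_Diff_subset, auto)
  also have "\<dots> = 4 ^ (n + 1 - k) - 4 ^ (n - k)"
    using assms by (simp add: card_toeplitz_mats_nullity_ge)
  also have "n + 1 - k = Suc (n - k)" using assms by simp
  finally show ?thesis by simp
qed

lemma toeplitz_mats_nullity_full: "toeplitz_mats_nullity n (n + 1) = {0\<^sub>m (n + 1) (n + 1)}"
proof -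
  have dim_le: "kernel_dim A \<le> n + 1" if "A \<in> toeplitz_mats n" for A
  proof -
    from that obtain s where "A = toeplitz_seq n s"
      using bij_betw_imp_surj_on[OF bij_betw_toeplitz_seq[of n, where 'a = bit]]
      by (auto simp: toeplitz_mats_def)
    hence "2 ^ kernel_dim A \<le> (2 :: nat) ^ (n + 1)"
      using card_annihilator_le[of "2 * n" s n] card_mat_kernel[of A]
      by (simp add: card_mat_kernel_toeplitz_seq CARD_bit)
    thus ?thesis by (subst (asm) power_increasing_iff) auto
  qed
  have "card (toeplitz_mats_nullity n (n + 1)) = card {A \<in> toeplitz_mats n. n + 1 \<le> kernel_dim A}"
    using dim_le by (intro arg_cong[where f = card]) (auto simp: toeplitz_mats_nullity_def intro: antisym)
  hence card: "card (toeplitz_mats_nullity n (n + 1)) = 1"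
    using card_toeplitz_mats_nullity_ge[of "n + 1" n] by simp
  have "(0\<^sub>m (n + 1) (n + 1) :: bit mat) = toeplitz_seq n (\<lambda>_. 0)"
    by (intro eq_matI) (auto simp: toeplitz_seq_def)
  moreover have "annihilator (2 * n) (\<lambda>_. 0 :: bit) n = {p. degree p \<le> n}"
    by (auto simp: in_annihilator_iff)
  ultimately have "2 ^ kernel_dim (0\<^sub>m (n + 1) (n + 1) :: bit mat) = (2 :: nat) ^ (n + 1)"
    using card_mat_kernel[of "0\<^sub>m (n + 1) (n + 1) :: bit mat"]
    by (simp add: card_mat_kernel_toeplitz_seq CARD_bit card_degree_le)
  hence "kernel_dim (0\<^sub>m (n + 1) (n + 1) :: bit mat) = n + 1"
    by (subst (asm) power_inject_exp) auto
  moreover have "(0\<^sub>m (n + 1) (n + 1) :: bit mat) = toeplitz_mat n (\<lambda>_. 0) (\<lambda>_. 0)"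
    by (intro eq_matI) (auto simp: toeplitz_mat_def)
  ultimately have "0\<^sub>m (n + 1) (n + 1) \<in> toeplitz_mats_nullity n (n + 1)"
    by (auto simp: toeplitz_mats_nullity_def toeplitz_mats_def)
  with card show ?thesis by (auto simp: card_1_singleton_iff)
qed

theorem mainTheorem4:
  fixes n :: nat
  assumes "n \<ge> 1"
  shows "(\<forall>k. 1 \<le> k \<and> k \<le> n \<longrightarrow>
            card (toeplitz_mats_nullity n k) = 2 ^ (2 * n - 2 * k) + 2 ^ (2 * n - 2 * k + 1))
    \<and> card (toeplitz_mats_nullity n 1) = 2 ^ (2 * n - 2) + 2 ^ (2 * n - 1)
    \<and> (n \<ge> 2 \<longrightarrow> card (toeplitz_mats_nullity n 2) = 2 ^ (2 * n - 4) + 2 ^ (2 * n - 3))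
    \<and> card (toeplitz_mats_nullity n n) = 3
    \<and> card (toeplitz_mats_nullity n (n + 1)) = 1
    \<and> toeplitz_mats_nullity n (n + 1) = {0\<^sub>m (n + 1) (n + 1)}"
proof -
  have main: "card (toeplitz_mats_nullity n k) = 2 ^ (2 * n - 2 * k) + 2 ^ (2 * n - 2 * k + 1)"
    if "1 \<le> k" "k \<le> n" for k
  proof -
    have "(4 :: nat) ^ (n - k) = 2 ^ (2 * n - 2 * k)"
      using power_mult[of "2 :: nat" 2 "n - k"] by (simp add: diff_mult_distrib2)
    with card_toeplitz_mats_nullity[OF that] show ?thesis by simp
  qed
  have one: "2 * n - 1 = 2 * n - 2 * 1 + 1" using assms by simp
  have two: "2 * n - 3 = 2 * n - 2 * 2 + 1" if "n \<ge> 2" using that by simp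
  have "card (toeplitz_mats_nullity n 1) = 2 ^ (2 * n - 2) + 2 ^ (2 * n - 1)"
    using main[of 1] assms unfolding one by simp
  moreover have "card (toeplitz_mats_nullity n 2) = 2 ^ (2 * n - 4) + 2 ^ (2 * n - 3)" if "n \<ge> 2"
    using main[of 2] that unfolding two[OF that] by simp
  moreover have "card (toeplitz_mats_nullity n n) = 3"
    using card_toeplitz_mats_nullity[of n n] assms by simp
  ultimately show ?thesis
    using main toeplitz_mats_nullity_full[of n] by simp
qed

end
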